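(* Let $G$ be a countable amenable group acting on a compact metric space $(X,\rho)$. The function $(X,D_W)\ni x\mapsto\mathcal M_G(\overline{Gx})\in(2^{\mathcal M(X)},H)$ is uniformly continuous, i.e. for every $\varepsilon>0$ there is $\delta>0$ such that for all $x,y\in X$ with $D_W(x,y)<\delta$ one has $H(\mathcal M_G(\overline{Gx}),\mathcal M_G(\overline{Gy}))<\varepsilon$.
   Context: $G$ is a discrete countable amenable group with identity $e$; $(X,\rho)$ is a compact metric space of diameter at most $1$; $G$ acts on $X$ via a continuous map $G\times X\to X$, $(g,x)\mapsto gx$, with $ex=x$ and $g(hx)=(gh)x$. $\overline{Gx}$ is the closure of the orbit $Gx=\{gx:g\in G\}$. A (left) Følner sequence is a sequence $\{F_n\}$ of non-empty finite subsets of $G$ with $|gF_n\triangle F_n|/|F_n|\to0$ for every $g\in G$. Weyl pseudometric: for $x,z\in X$, $D_W(x,z)=\limsup_{n\to\infty}\frac1{|F_n|}\sup_{g\in G}\sum_{f\in F_ng}\rho(fx,fz)$ for a Følner sequence $\{F_n\}$ (the value does not depend on the Følner sequence). $\mathcal M(X)$ is the set of Borel probability measures on $X$ with the weak* topology, metrized by the Prokhorov metric $D_P(\mu,\nu)=\inf\{\varepsilon>0:\mu(B)\le\nu(B^\varepsilon)+\varepsilon\text{ for every Borel }B\subset X\}$, where $B^\varepsilon=\{y\in X:\exists x\in B,\ \rho(x,y)<\varepsilon\}$. $\mathcal M_G(\overline{Gx})$ is the set of $G$-invariant Borel probability measures on $\overline{Gx}$, regarded as a subset of $\mathcal M(X)$.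 $2^{\mathcal M(X)}$ is the space of non-empty compact subsets of $(\mathcal M(X),D_P)$ and $H$ is the Hausdorff distance on it: $H(A,B)=\max\{\inf\{\varepsilon>0:A\subset B^\varepsilon\},\inf\{\varepsilon>0:B\subset A^\varepsilon\}\}$ with $\varepsilon$-neighbourhoods taken with respect to $D_P$. *)

theory Defs
  imports "HOL-Probability.Probability" "HOL-Algebra.Group_Action"
begin

definition folner_sequence :: "('g, 'b) monoid_scheme \<Rightarrow> (nat \<Rightarrow> 'g set) \<Rightarrow> bool" where
  "folner_sequence G F \<longleftrightarrow>
     (\<forall>n. F n \<subseteq> carrier G \<and> finite (F n) \<and> F n \<noteq> {}) \<and>
     (\<forall>g\<in>carrier G.
        (\<lambda>n. real (card (sym_diff (g <#\<^bsub>G\<^esub> F n) (F n))) / real (card (F n))) \<longlonglongrightarrow> 0)"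

definition amenable :: "('g, 'b) monoid_scheme \<Rightarrow> bool" where
  "amenable G \<longleftrightarrow> (\<exists>F. folner_sequence G F)"

(* The supremum and the limsup are taken in ereal, so that neither depends on a
   boundedness side condition; on a bounded space the value is a finite real. *)
definition weyl_dist ::
  "('g, 'b) monoid_scheme \<Rightarrow> (nat \<Rightarrow> 'g set) \<Rightarrow> ('g \<Rightarrow> 'x \<Rightarrow> 'x) \<Rightarrow> 'x::metric_space \<Rightarrow> 'x \<Rightarrow> ereal" where
  "weyl_dist G F \<phi> x z =
     limsup (\<lambda>n. ereal (1 / real (card (F n))) *
       (SUP g\<in>carrier G. ereal (\<Sum>f\<in>F n #>\<^bsub>G\<^esub> g. dist (\<phi> f x) (\<phi> f z))))"

definition eps_nbhd :: "'p set \<Rightarrow> ('p \<Rightarrow> 'p \<Rightarrow> real) \<Rightarrow> 'p set \<Rightarrow> real \<Rightarrow> 'p set" where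
  "eps_nbhd S d B \<epsilon> = {y \<in> S. \<exists>x\<in>B. d x y < \<epsilon>}"

definition borel_prob_measures :: "'x::topological_space measure set" where
  "borel_prob_measures = {\<mu>. sets \<mu> = sets borel \<and> prob_space \<mu>}"

(* For probability measures the set below contains 1, so the real infimum is genuine. *)
definition prokhorov_dist :: "'x::metric_space measure \<Rightarrow> 'x measure \<Rightarrow> real" where
  "prokhorov_dist \<mu> \<nu> =
     Inf {\<epsilon>. 0 < \<epsilon> \<and>
            (\<forall>B\<in>sets borel. measure \<mu> B \<le> measure \<nu> (eps_nbhd UNIV dist B \<epsilon>) + \<epsilon>)}"

(* A Borel probability measure on the closed set K is identified with its extension by zero to
   the whole space, i.e. with a measure giving K full mass.  For an invariant K, invariance
   of the measure on K and of its extension mean the same. *)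
definition invariant_measures ::
  "('g, 'b) monoid_scheme \<Rightarrow> ('g \<Rightarrow> 'x \<Rightarrow> 'x) \<Rightarrow> 'x::topological_space set \<Rightarrow> 'x measure set" where
  "invariant_measures G \<phi> K =
     {\<mu> \<in> borel_prob_measures. measure \<mu> K = 1 \<and>
        (\<forall>g\<in>carrier G. distr \<mu> borel (\<phi> g) = \<mu>)}"

(* The infima are taken in ereal: if no \<epsilon> qualifies (which for a bounded d happens only if
   exactly one of the two sets is empty), the distance is infinite instead of arbitrary. *)
definition hausdorff_dist :: "'p set \<Rightarrow> ('p \<Rightarrow> 'p \<Rightarrow> real) \<Rightarrow> 'p set \<Rightarrow> 'p set \<Rightarrow> ereal" where
  "hausdorff_dist S d A B =
     max (Inf {ereal \<epsilon> |\<epsilon>. 0 < \<epsilon> \<and> A \<subseteq> eps_nbhd S d B \<epsilon>})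
         (Inf {ereal \<epsilon> |\<epsilon>. 0 < \<epsilon> \<and> B \<subseteq> eps_nbhd S d A \<epsilon>})"

end

theory Submission
  imports Defs
begin

text \<open>
  The map is controlled by joinings. Suppose that $D_W(x, y) < \eta^2$ and let \<open>\<mu>\<close> be an invariant
  measure on the orbit closure of \<open>x\<close>. Let \<open>K\<close> be the closure of the orbit of \<open>(x, y)\<close> under the
  diagonal action. The first projection maps \<open>K\<close> equivariantly onto the orbit closure of \<open>x\<close>, and since
  the group is amenable, \<open>\<mu>\<close> lifts to an invariant measure \<open>\<kappa>\<close> on \<open>K\<close> (\<open>exists_invariant_lift\<close>). The
  second marginal \<open>\<nu>\<close> of \<open>\<kappa>\<close> is an invariant measure on the orbit closure of \<open>y\<close>. Invariance lets one
  replace the distance of the coordinates, under the integral over \<open>\<kappa>\<close>, by its averages over the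
  Folner sets, and on the orbit of \<open>(x, y)\<close> these averages are exactly what the Weyl pseudometric
  bounds; hence \<open>\<integral> dist d\<kappa> \<le> D_W(x, y)\<close> (\<open>integral_dist_le_weyl_dist\<close>). Markov's inequality turns this
  into a Prokhorov distance of at most \<open>\<eta>\<close> between \<open>\<nu>\<close> and \<open>\<mu>\<close> (\<open>prokhorov_dist_le_of_coupling\<close>). As
  the Weyl pseudometric is symmetric, the same holds with \<open>x\<close> and \<open>y\<close> exchanged. The modulus \<open>\<eta>\<^sup>2\<close> does
  not depend on \<open>x\<close> and \<open>y\<close>, so the continuity is uniform.

  The lift rests on two facts about a compact metric space: continuous maps on it have Borel
  sections, and sequences of probability measures on it have weakly convergent subsequences. Both
  are reduced to the real line by presenting the space as a continuous image of a compact set of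
  reals (\<open>compact_metric_image_of_real_compact\<close>): there a section is given by least elements, and weak
  convergence of a subsequence is Helly's theorem.
\<close>

section \<open>Compact metric spaces as continuous images of compact sets of reals\<close>

text \<open>
  Injectivity of the Cantor coding of binary sequences, stated for the difference of two of them:
  the first nonzero digit, at place $k$, contributes $3^{-k}$ in absolute value, while all later
  digits together contribute at most half of that.
\<close>
lemma ternary_expansion_zero:
  fixes \<gamma> :: "nat \<Rightarrow> real"
  assumes digit: "\<And>i. \<gamma> i \<in> {-1, 0, 1}" and zero: "(\<Sum>i. \<gamma> i / 3 ^ i) = 0"
  shows "\<gamma> i = 0"
proof (rule ccontr)
  assume "\<gamma> i \<noteq> 0"
  then obtain k where k: "\<gamma> k \<noteq> 0" and min: "\<And>j. j < k \<Longrightarrow> \<gamma> j = 0"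
    using exists_least_iff[of "\<lambda>i. \<gamma> i \<noteq> 0"] by blast
  have geo: "(\<lambda>j. (1/3) ^ j * (1 / 3 ^ Suc k)) sums ((3/2) * (1 / 3 ^ Suc k) :: real)"
    using sums_mult2[OF geometric_sums[of "1/3::real"], of "1 / 3 ^ Suc k"] by simp
  have abs1: "\<bar>\<gamma> j\<bar> \<le> 1" for j
    using digit[of j] by auto
  have le: "norm (\<gamma> (j + Suc k) / 3 ^ (j + Suc k)) \<le> (1/3) ^ j * (1 / 3 ^ Suc k)" for j
  proof -
    have "norm (\<gamma> (j + Suc k) / 3 ^ (j + Suc k)) = \<bar>\<gamma> (j + Suc k)\<bar> / 3 ^ (j + Suc k)"
      by (simp add: abs_divide)
    also have "\<dots> \<le> 1 / 3 ^ (j + Suc k)"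
      using abs1 by (intro divide_right_mono) auto
    also have "\<dots> = (1/3) ^ j * (1 / 3 ^ Suc k)"
      by (simp add: power_add power_divide)
    finally show ?thesis .
  qed
  have sum_norm: "summable (\<lambda>j. norm (\<gamma> (j + Suc k) / 3 ^ (j + Suc k)))"
    using le by (intro summable_comparison_test'[OF sums_summable[OF geo], of 0]) auto
  have tail: "summable (\<lambda>j. \<gamma> (j + Suc k) / 3 ^ (j + Suc k))"
    using summable_norm_cancel[OF sum_norm] .
  then have summ: "summable (\<lambda>j. \<gamma> j / 3 ^ j)"
    by (subst (asm) summable_iff_shift)
  have "(\<Sum>j. \<gamma> j / 3 ^ j) = (\<Sum>j. \<gamma> (j + Suc k) / 3 ^ (j + Suc k)) + (\<Sum>j<Suc k. \<gamma> j / 3 ^ j)"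
    by (rule suminf_split_initial_segment[OF summ])
  also have "(\<Sum>j<Suc k. \<gamma> j / 3 ^ j) = \<gamma> k / 3 ^ k"
    using min by simp
  finally have eq: "\<gamma> k / 3 ^ k = - (\<Sum>j. \<gamma> (j + Suc k) / 3 ^ (j + Suc k))"
    using zero by simp
  have "1 / 3 ^ k = \<bar>\<gamma> k / 3 ^ k\<bar>"
    using digit[of k] k by (auto simp: abs_divide)
  also have "\<dots> \<le> (\<Sum>j. norm (\<gamma> (j + Suc k) / 3 ^ (j + Suc k)))"
    unfolding eq using summable_norm[OF sum_norm] by simp
  also have "\<dots> \<le> (3/2) * (1 / 3 ^ Suc k)"
    using suminf_le[OF le sum_norm sums_summable[OF geo]] sums_unique[OF geo] by simp
  also have "\<dots> < 1 / 3 ^ k"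
    by (simp add: field_simps)
  finally show False by simp
qed

lemma compact_binary_sequences: "compact {\<alpha> :: nat \<Rightarrow> real. \<forall>i. \<alpha> i \<in> {0, 1}}"
proof -
  have "compactin (product_topology (\<lambda>i::nat. euclidean :: real topology) UNIV) (PiE UNIV (\<lambda>i. {0, 1}))"
    unfolding compactin_PiE by auto
  moreover have "PiE UNIV (\<lambda>i::nat. {0, 1::real}) = {\<alpha>. \<forall>i. \<alpha> i \<in> {0, 1}}"
    by (auto simp: PiE_def)
  ultimately show ?thesis
    by (simp add: euclidean_product_topology)
qed

text \<open>
  A point \<open>u\<close> is coded by the binary sequences that choose, for each \<open>i\<close>, one of \<open>A i\<close> and \<open>B i\<close>
  containing \<open>u\<close>. The pairs (code, point) form a compact set \<open>W\<close>; the separation hypothesis says that a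
  code determines its point, so writing codes as ternary expansions embeds \<open>W\<close> into the reals, and
  the second projection of \<open>W\<close> becomes the required map. A point may have several codes, which is
  why one obtains a surjection and not an embedding of \<open>K\<close>.
\<close>
lemma continuous_map_from_real_compact_of_separation:
  fixes K :: "'a::topological_space set" and A B :: "nat \<Rightarrow> 'a set"
  assumes K: "compact K" and clA: "\<And>i. closed (A i)" and clB: "\<And>i. closed (B i)"
    and cover: "\<And>i. K \<subseteq> A i \<union> B i"
    and sep: "\<And>u v. u \<in> K \<Longrightarrow> v \<in> K \<Longrightarrow> u \<noteq> v \<Longrightarrow> \<exists>i. u \<notin> B i \<and> v \<notin> A i"
  obtains C :: "real set" and p where "compact C" "continuous_on C p" "p ` C = K"
proof -
  define Z where "Z = {\<alpha> :: nat \<Rightarrow> real. \<forall>i. \<alpha> i \<in> {0, 1}}"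
  define c where "c = (\<lambda>\<alpha> :: nat \<Rightarrow> real. \<Sum>i. \<alpha> i / 3 ^ i)"
  define W where "W = (Z \<times> K) \<inter> (\<Inter>i. ({w. fst w i = 0} \<union> {w. snd w \<in> A i}) \<inter>
                                    ({w. fst w i = 1} \<union> {w. snd w \<in> B i}))"
  have summ: "summable (\<lambda>i. \<alpha> i / 3 ^ i)" if "\<alpha> \<in> Z" for \<alpha>
  proof (rule summable_comparison_test'[of "\<lambda>i. (1/3::real) ^ i" 0])
    show "norm (\<alpha> i / 3 ^ i) \<le> (1/3) ^ i" for i
      using that unfolding Z_def by (auto simp: power_divide dest!: spec[of _ i])
  qed (simp add: summable_geometric)
  have coord: "continuous_on UNIV (\<lambda>w :: (nat \<Rightarrow> real) \<times> 'a. fst w i)" for i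
    by (intro continuous_on_product_then_coordinatewise[of _ fst] continuous_intros)
  have comp: "compact W"
  proof -
    have "compact (Z \<times> K)"
      using compact_binary_sequences K by (auto simp: Z_def intro: compact_Times)
    moreover have "closed {w :: (nat \<Rightarrow> real) \<times> 'a. snd w \<in> A i}" "closed {w :: (nat \<Rightarrow> real) \<times> 'a. snd w \<in> B i}" for i
      using closed_vimage_snd[OF clA[of i]] closed_vimage_snd[OF clB[of i]] by (auto simp: vimage_def)
    moreover have "closed {w :: (nat \<Rightarrow> real) \<times> 'a. fst w i = t}" for i t
      by (intro closed_Collect_eq coord continuous_intros)
    ultimately show ?thesis
      unfolding W_def by (intro compact_Int_closed closed_INT ballI closed_Int closed_Un)
  qed
  have cont: "continuous_on W (\<lambda>w. c (fst w))"
  proof -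
    have lim: "uniform_limit W (\<lambda>n w. \<Sum>i<n. fst w i / 3 ^ i) (\<lambda>w. \<Sum>i. fst w i / 3 ^ i) sequentially"
    proof (rule Weierstrass_m_test[where M = "\<lambda>i. (1/3::real) ^ i"])
      show "norm (fst w i / 3 ^ i) \<le> (1/3) ^ i" if "w \<in> W" for w i
        using that unfolding W_def Z_def by (auto simp: power_divide dest!: spec[of _ i])
    qed (simp add: summable_geometric)
    have "continuous_on W (\<lambda>w. \<Sum>i<n. fst w i / 3 ^ i)" for n
      by (intro continuous_intros continuous_on_subset[OF coord]) auto
    then show ?thesis
      unfolding c_def by (intro uniform_limit_theorem[OF _ lim]) auto
  qed
  have inj: "inj_on (\<lambda>w. c (fst w)) W"
  proof (rule inj_onI)
    fix w w' assume w: "w \<in> W" and w': "w' \<in> W" and eq: "c (fst w) = c (fst w')"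
    have Zw: "fst w \<in> Z" "fst w' \<in> Z"
      using w w' by (auto simp: W_def)
    have "fst w i - fst w' i = 0" for i
    proof (rule ternary_expansion_zero[of "\<lambda>i. fst w i - fst w' i"])
      show "fst w i - fst w' i \<in> {- 1, 0, 1}" for i
      proof -
        have "fst w i \<in> {0,1}" "fst w' i \<in> {0,1}"
          using Zw unfolding Z_def by blast+
        then show ?thesis by auto
      qed
      show "(\<Sum>i. (fst w i - fst w' i) / 3 ^ i) = 0"
        using suminf_diff[OF summ[OF Zw(1)] summ[OF Zw(2)]] eq
        by (simp add: c_def diff_divide_distrib)
    qed
    then have fst_eq: "fst w = fst w'" by auto
    moreover have "snd w = snd w'"
    proof (rule ccontr)
      assume "snd w \<noteq> snd w'"
      then obtain i where i: "snd w \<notin> B i" "snd w' \<notin> A i"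
        using sep w w' unfolding W_def by force
      have "fst w i = 1" "fst w' i = 0"
        using w w' i unfolding W_def by auto
      then show False using fst_eq by simp
    qed
    ultimately show "w = w'" by (simp add: prod_eq_iff)
  qed
  define C where "C = (\<lambda>w. c (fst w)) ` W"
  define q where "q = inv_into W (\<lambda>w. c (fst w))"
  have "compact C"
    unfolding C_def by (rule compact_continuous_image[OF cont comp])
  moreover have "continuous_on C (\<lambda>t. snd (q t))"
    unfolding C_def q_def
    by (intro continuous_on_snd continuous_on_inv[OF cont comp]) (use inv_into_f_f[OF inj] in blast)
  moreover have "(\<lambda>t. snd (q t)) ` C = K"
  proof -
    have "(\<lambda>t. snd (q t)) ` C = snd ` W"
      unfolding C_def q_def image_image using inv_into_f_f[OF inj] by (intro image_cong) auto
    also have "\<dots> = K"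
    proof (intro equalityI subsetI)
      fix u assume u: "u \<in> K"
      define \<alpha> where "\<alpha> = (\<lambda>i. if u \<in> A i then 1 else 0 :: real)"
      have "(\<alpha>, u) \<in> W"
        using u cover unfolding W_def Z_def \<alpha>_def by auto
      then show "u \<in> snd ` W" by force
    qed (auto simp: W_def)
    finally show ?thesis .
  qed
  ultimately show ?thesis using that by blast
qed

text \<open>
  The Hausdorff-Alexandroff theorem, with a compact set of reals in place of the Cantor set. The
  separating closed covers are \<open>{cball x r, - ball x r}\<close> with centres in finite nets of \<open>K\<close>.
\<close>
lemma compact_metric_image_of_real_compact:
  fixes K :: "'a::metric_space set"
  assumes "compact K"
  obtains C :: "real set" and p where "compact C" "continuous_on C p" "p ` C = K"
proof (cases "K = {}")
  case True
  then show ?thesis using that[of "{}" "\<lambda>_. undefined"] by auto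
next
  case False
  have "\<exists>k. finite k \<and> k \<subseteq> K \<and> K \<subseteq> (\<Union>x\<in>k. ball x (inverse (Suc n)))" for n
  proof -
    have "\<And>x. x \<in> K \<Longrightarrow> open (ball x (inverse (real (Suc n))))" and "K \<subseteq> (\<Union>x\<in>K. ball x (inverse (real (Suc n))))"
      by (auto intro: centre_in_ball[THEN iffD2])
    from compactE_image[OF assms this] show ?thesis by metis
  qed
  then obtain k where k: "\<And>n. finite (k n)" "\<And>n. k n \<subseteq> K" "\<And>n. K \<subseteq> (\<Union>x\<in>k n. ball x (inverse (Suc n)))"
    by metis
  define I where "I = (SIGMA n:UNIV. k n)"
  have "countable I"
    unfolding I_def by (rule countable_SIGMA) (auto intro: countable_finite k(1))
  moreover have "I \<noteq> {}"
    using k(3)[of 0] False by (auto simp: I_def)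
  ultimately have I: "countable I" "I \<noteq> {}" by auto
  define e where "e = from_nat_into I"
  \<comment> \<open>Points \<open>u\<close>, \<open>v\<close> are separated at a mesh below a third of their distance. The radius is
    twice the mesh, so that some net point is closer to \<open>u\<close> than the
    radius while \<open>v\<close>, at more than three meshes from \<open>u\<close>, stays outside the closed ball.\<close>
  define r where "r i = 2 * inverse (real (Suc (fst (e i))))" for i
  show ?thesis
  proof (rule continuous_map_from_real_compact_of_separation[OF assms, where A = "\<lambda>i. cball (snd (e i)) (r i)" and B = "\<lambda>i. - ball (snd (e i)) (r i)"])
    fix u v assume u: "u \<in> K" and v: "v \<in> K" and "u \<noteq> v"
    then obtain n where n: "inverse (real (Suc n)) < dist u v / 3"
      using reals_Archimedean[of "dist u v / 3"] by auto
    obtain x where x: "x \<in> k n" "dist x u < inverse (Suc n)"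
      using k(3)[of n] u by auto
    obtain i where i: "e i = (n, x)"
      using from_nat_into_surj[OF I(1), of "(n, x)"] x(1) by (auto simp: I_def e_def)
    have "dist u v \<le> dist x u + dist x v"
      by (metis dist_commute dist_triangle)
    then have "dist x u < r i" "r i < dist x v"
      using n x(2) zero_le_dist[of x u] unfolding r_def i fst_conv by linarith+
    then show "\<exists>i. u \<notin> - ball (snd (e i)) (r i) \<and> v \<notin> cball (snd (e i)) (r i)"
      by (intro exI[of _ i]) (simp add: i)
  next
    show "K \<subseteq> cball (snd (e i)) (r i) \<union> - ball (snd (e i)) (r i)" for i
      by auto
  qed (use that in \<open>auto simp: closed_Compl\<close>)
qed

section \<open>Borel sections\<close>

text \<open>
  On the real line a selection is canonical: take the least point of each fibre. Its sublevel sets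
  are images of compact sets, hence closed, up to the default value outside the image.
\<close>
lemma borel_section_of_real_compact:
  fixes C :: "real set" and q :: "real \<Rightarrow> 'b::metric_space"
  assumes C: "compact C" and q: "continuous_on C q"
  obtains s where "s \<in> borel_measurable borel" "\<And>u. u \<in> q ` C \<Longrightarrow> s u \<in> C" "\<And>u. u \<in> q ` C \<Longrightarrow> q (s u) = u"
proof -
  define s where "s u = (if u \<in> q ` C then Inf {c \<in> C. q c = u} else 0)" for u
  have min: "s u \<in> C \<and> q (s u) = u \<and> (\<forall>c\<in>C. q c = u \<longrightarrow> s u \<le> c)" if u: "u \<in> q ` C" for u
  proof -
    have "closed (C \<inter> q -` {u})"
      by (rule continuous_closed_preimage[OF q compact_imp_closed[OF C]]) simp
    then have "compact (C \<inter> (C \<inter> q -` {u}))"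
      by (rule compact_Int_closed[OF C])
    moreover have "C \<inter> (C \<inter> q -` {u}) \<noteq> {}"
      using u by auto
    ultimately obtain m where m: "m \<in> C" "q m = u" "\<And>c. c \<in> C \<Longrightarrow> q c = u \<Longrightarrow> m \<le> c"
      using compact_attains_inf[of "C \<inter> (C \<inter> q -` {u})"] by auto
    have "Inf {c \<in> C. q c = u} = m"
      by (rule cInf_eq_minimum) (use m in auto)
    then show ?thesis
      using m u by (auto simp: s_def)
  qed
  have cl: "closed (q ` (C \<inter> D))" if "closed D" for D
    by (intro compact_imp_closed compact_continuous_image continuous_on_subset[OF q]
        compact_Int_closed[OF C that]) auto
  have "s \<in> borel_measurable borel"
  proof (rule borel_measurableI_le)
    fix t
    have "{u \<in> space borel. s u \<le> t} = q ` (C \<inter> {..t}) \<union> (if 0 \<le> t then - q ` C else {})"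
    proof (rule Set.set_eqI)
      fix u
      show "u \<in> {u \<in> space borel. s u \<le> t} \<longleftrightarrow> u \<in> q ` (C \<inter> {..t}) \<union> (if 0 \<le> t then - q ` C else {})"
      proof (cases "u \<in> q ` C")
        case True
        have "s u \<le> t \<longleftrightarrow> u \<in> q ` (C \<inter> {..t})"
        proof
          assume "s u \<le> t"
          then show "u \<in> q ` (C \<inter> {..t})"
            using min[OF True] by (intro image_eqI[of _ _ "s u"]) auto
        next
          assume "u \<in> q ` (C \<inter> {..t})"
          then show "s u \<le> t"
            using min[OF True] by (auto intro: order_trans)
        qed
        then show ?thesis using True by simp
      next
        case False
        then have "s u = 0" "u \<notin> q ` (C \<inter> {..t})"
          by (auto simp: s_def)
        then show ?thesis using False by simp
      qed
    qed
    also have "\<dots> \<in> sets borel"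
      using cl[of "{..t}"] cl[of UNIV] by auto
    finally show "{u \<in> space borel. s u \<le> t} \<in> sets borel" .
  qed
  then show ?thesis
    using min that by blast
qed

lemma borel_measurable_extend_continuous:
  fixes p :: "'a::topological_space \<Rightarrow> 'b::metric_space"
  assumes "closed C" "continuous_on C p"
  shows "(\<lambda>t. if t \<in> C then p t else d) \<in> borel_measurable borel"
proof (rule measurable_If_restrict_space_iff[THEN iffD2])
  show "{t \<in> space borel. t \<in> C} \<in> sets borel" using assms(1) by simp
  show "p \<in> borel_measurable (restrict_space borel {x. x \<in> C}) \<and>
    (\<lambda>t. d) \<in> borel_measurable (restrict_space borel {x. x \<notin> C})"
    using borel_measurable_continuous_on_restrict[OF assms(2)] by auto
qed

text \<open>
  Precomposing \<open>f\<close> with a parametrisation of \<open>K\<close> by a compact set of reals reduces the selection problem to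
  the one where least elements exist.
\<close>
lemma borel_section_of_compact:
  fixes f :: "'a::metric_space \<Rightarrow> 'b::metric_space"
  assumes K: "compact K" and f: "continuous_on K f"
  obtains s where "s \<in> borel_measurable borel" "\<And>u. u \<in> f ` K \<Longrightarrow> s u \<in> K" "\<And>u. u \<in> f ` K \<Longrightarrow> f (s u) = u"
proof -
  obtain C :: "real set" and p where C: "compact C" "continuous_on C p" "p ` C = K"
    using compact_metric_image_of_real_compact[OF K] by blast
  obtain s where s: "s \<in> borel_measurable borel" "\<And>u. u \<in> (f \<circ> p) ` C \<Longrightarrow> s u \<in> C"
      "\<And>u. u \<in> (f \<circ> p) ` C \<Longrightarrow> (f \<circ> p) (s u) = u"
    using borel_section_of_real_compact[OF C(1), of "f \<circ> p"] f C(2,3)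
    by (metis continuous_on_compose)
  define p' where "p' = (\<lambda>t. if t \<in> C then p t else undefined)"
  have "p' \<in> borel_measurable borel"
    unfolding p'_def by (intro borel_measurable_extend_continuous compact_imp_closed C)
  then have "(\<lambda>u. p' (s u)) \<in> borel_measurable borel"
    using s(1) by measurable
  moreover have im: "(f \<circ> p) ` C = f ` K"
    using C(3) by (auto simp: image_comp[symmetric])
  moreover have "p' (s u) \<in> K" "f (p' (s u)) = u" if "u \<in> f ` K" for u
    using s(2,3)[of u] that C(3) im unfolding p'_def by auto
  ultimately show ?thesis using that by blast
qed

section \<open>Weak limits of measures on a compact metric space\<close>

text \<open>
  The indicator of a closed set is the decreasing limit of the functions
  \<open>max 0 (1 - n * infdist x A)\<close>, and the closed sets generate the Borel sets.
\<close>
lemma borel_measure_eqI_continuous: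
  fixes M N :: "'a::metric_space measure"
  assumes M: "finite_measure M" "sets M = sets borel" and N: "finite_measure N" "sets N = sets borel"
    and eq: "\<And>h :: 'a \<Rightarrow> real. continuous_on UNIV h \<Longrightarrow> (\<And>x. 0 \<le> h x \<and> h x \<le> 1) \<Longrightarrow> integral\<^sup>L M h = integral\<^sup>L N h"
  shows "M = N"
proof -
  interpret M: finite_measure M by fact
  interpret N: finite_measure N by fact
  note [measurable_cong] = M(2) N(2)
  have closed_eq: "measure M A = measure N A" if A: "closed A" for A
  proof (cases "A = {}")
    case False
    define h where "h = (\<lambda>n x. max 0 (1 - real n * infdist x A))"
    have cont: "continuous_on UNIV (h n)" for n
      unfolding h_def by (intro continuous_intros)
    have [measurable]: "h n \<in> borel_measurable borel" for n
      using cont by (rule borel_measurable_continuous_onI)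
    have bd: "0 \<le> h n x \<and> h n x \<le> 1" for n x
      by (auto simp: h_def infdist_nonneg)
    have lim: "(\<lambda>n. h n x) \<longlonglongrightarrow> indicator A x" for x
    proof (cases "x \<in> A")
      case True
      then show ?thesis by (simp add: h_def)
    next
      case x: False
      then have "0 < infdist x A"
        using in_closed_iff_infdist_zero[OF A False] infdist_nonneg[of x A] by (simp add: less_le)
      then obtain m where "1 < real m * infdist x A"
        using reals_Archimedean3 by blast
      then have "1 - real n * infdist x A \<le> 0" if "m \<le> n" for n
        using that mult_right_mono[of "real m" "real n" "infdist x A"] infdist_nonneg[of x A] by simp
      then have "h n x = 0" if "m \<le> n" for n
        using that by (auto simp: h_def max_def intro: antisym)
      then have "\<forall>\<^sub>F n in sequentially. h n x = indicator A x"
        using x by (intro eventually_sequentiallyI[of m]) simp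
      then show ?thesis by (rule tendsto_eventually)
    qed
    have [measurable]: "A \<in> sets borel" using A by simp
    have "(\<lambda>n. integral\<^sup>L M (h n)) \<longlonglongrightarrow> integral\<^sup>L M (indicator A)"
      by (rule integral_dominated_convergence[where w = "\<lambda>_. 1"]) (use bd lim in \<open>auto\<close>)
    moreover have "(\<lambda>n. integral\<^sup>L N (h n)) \<longlonglongrightarrow> integral\<^sup>L N (indicator A)"
      by (rule integral_dominated_convergence[where w = "\<lambda>_. 1"]) (use bd lim in \<open>auto\<close>)
    ultimately have "integral\<^sup>L M (indicator A) = (integral\<^sup>L N (indicator A) :: real)"
      using eq[OF cont bd] LIMSEQ_unique by simp
    then show ?thesis
      using sets_eq_imp_space_eq[OF M(2)] sets_eq_imp_space_eq[OF N(2)] by simp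
  qed simp
  show ?thesis
  proof (rule measure_eqI_generator_eq[where E = "Collect closed" and \<Omega> = UNIV and A = "\<lambda>_. UNIV"])
    show "sets M = sigma_sets UNIV (Collect closed)" "sets N = sigma_sets UNIV (Collect closed)"
      using M(2) N(2) by (simp_all add: borel_eq_closed)
    show "emeasure M X = emeasure N X" if "X \<in> Collect closed" for X
      using closed_eq[of X] that by (simp add: M.emeasure_eq_measure N.emeasure_eq_measure)
  qed (auto simp: Int_stable_def)
qed

text \<open>
  Sequential weak compactness is transferred from the real line, where it is Helly's selection
  theorem: parametrise \<open>K\<close> by a compact set \<open>C\<close> of reals, push the measures to \<open>C\<close> by a Borel section of
  the parametrisation \<open>p\<close>, and push a weak limit back by \<open>p\<close>. The section need not be continuous:
  an integral of \<open>h\<close> over \<open>K\<close> is an integral over \<open>C\<close> of the continuous function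
  \<open>h \<circ> p\<close>, which extends to a bounded continuous function on the line.
\<close>
lemma compact_imp_weakly_convergent_subsequence:
  fixes K :: "'a::metric_space set" and \<mu> :: "nat \<Rightarrow> 'a measure"
  assumes K: "compact K" and prob: "\<And>n. prob_space (\<mu> n)" and sets: "\<And>n. sets (\<mu> n) = sets borel"
    and full: "\<And>n. measure (\<mu> n) K = 1"
  obtains r \<mu>' where "strict_mono (r :: nat \<Rightarrow> nat)" "prob_space \<mu>'" "sets \<mu>' = sets borel" "measure \<mu>' K = 1"
    "\<And>h :: 'a \<Rightarrow> real. continuous_on UNIV h \<Longrightarrow> (\<lambda>n. integral\<^sup>L (\<mu> (r n)) h) \<longlonglongrightarrow> integral\<^sup>L \<mu>' h"
proof -
  note [measurable_cong] = sets
  interpret \<mu>: prob_space "\<mu> n" for n by (rule prob)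
  obtain C :: "real set" and p where C: "compact C" "continuous_on C p" "p ` C = K"
    using compact_metric_image_of_real_compact[OF K] by blast
  obtain s where s [measurable]: "s \<in> borel_measurable borel"
    and sC: "\<And>u. u \<in> K \<Longrightarrow> s u \<in> C" and ps: "\<And>u. u \<in> K \<Longrightarrow> p (s u) = u"
    using borel_section_of_real_compact[OF C(1,2)] C(3) by metis
  have clC: "closed C" by (rule compact_imp_closed[OF C(1)])
  have [measurable]: "C \<in> sets borel" "K \<in> sets borel"
    using clC compact_imp_closed[OF K] by auto
  have AE_K: "AE u in \<mu> n. u \<in> K" for n
    by (rule \<mu>.AE_prob_1[OF full])
  define \<nu> where "\<nu> n = distr (\<mu> n) borel s" for n
  have prob_\<nu>: "prob_space (\<nu> n)" for n
    unfolding \<nu>_def by (rule \<mu>.prob_space_distr) simp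
  have real_\<nu>: "real_distribution (\<nu> n)" for n
    by (simp add: real_distribution_def real_distribution_axioms_def prob_\<nu>) (simp add: \<nu>_def)
  have AE_\<nu>: "AE t in \<nu> n. t \<in> C" for n
    unfolding \<nu>_def by (subst AE_distr_iff) (use AE_K[of n] sC in \<open>auto elim!: eventually_mono\<close>)
  have "tight \<nu>"
    unfolding tight_def
  proof (intro conjI allI impI real_\<nu>)
    fix \<epsilon> :: real assume "0 < \<epsilon>"
    obtain b where b: "\<And>t. t \<in> C \<Longrightarrow> \<bar>t\<bar> \<le> b"
      using compact_imp_bounded[OF C(1)] unfolding bounded_iff by auto
    define b' where "b' = max b 0"
    have sub: "t \<in> {-b'-1<..b'}" if "t \<in> C" for t
      using b[OF that] by (auto simp: b'_def)
    have "measure (\<nu> n) {-b'-1<..b'} = 1" for n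
    proof -
      have "AE t in \<nu> n. t \<in> {-b'-1<..b'}"
        using AE_\<nu> by (rule eventually_mono) (rule sub)
      then show ?thesis
        by (subst prob_space.prob_eq_1[OF prob_\<nu>]) (auto simp: \<nu>_def)
    qed
    then show "\<exists>a b. a < b \<and> (\<forall>n. 1 - \<epsilon> < measure (\<nu> n) {a<..b})"
      using \<open>0 < \<epsilon>\<close> by (intro exI[of _ "-b'-1"] exI[of _ b']) (auto simp: b'_def)
  qed
  then obtain r N where r: "strict_mono (r :: nat \<Rightarrow> nat)" and N: "real_distribution N"
    and conv: "weak_conv_m (\<nu> \<circ> r) N"
    using tight_imp_convergent_subsubsequence[of \<nu> id] by (auto simp: strict_mono_id)
  interpret N: real_distribution N by fact
  have lim: "(\<lambda>n. integral\<^sup>L (\<nu> (r n)) f) \<longlonglongrightarrow> integral\<^sup>L N f"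
    if f: "continuous_on UNIV f" "\<And>t. norm (f t) \<le> B" for f :: "real \<Rightarrow> real" and B
  proof -
    have "isCont f t" for t
      using f(1) by (simp add: continuous_on_eq_continuous_at)
    from weak_conv_imp_integral_bdd_continuous_conv[OF _ N conv this f(2)] real_\<nu>
    show ?thesis by (simp add: comp_def)
  qed
  have neK: "K \<noteq> {}" using full[of 0] by auto
  have neC: "C \<noteq> {}" using neK C(3) by auto
  \<comment> \<open>The limit does not charge the complement of \<open>C\<close>, since the distance to \<open>C\<close>, truncated to be
    bounded, has integral zero along the sequence.\<close>
  have AE_N: "AE t in N. t \<in> C"
  proof -
    define f where "f t = min 1 (infdist t C)" for t
    have cont: "continuous_on UNIV f"
      unfolding f_def by (intro continuous_intros)
    have [measurable]: "f \<in> borel_measurable borel"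
      using cont by (rule borel_measurable_continuous_onI)
    have bd: "norm (f t) \<le> 1" "0 \<le> f t" for t
      by (auto simp: f_def infdist_nonneg)
    have "integral\<^sup>L (\<nu> n) f = 0" for n
      by (rule integral_eq_zero_AE)
        (use AE_\<nu>[of n] in \<open>auto elim!: eventually_mono simp: f_def\<close>)
    then have "integral\<^sup>L N f = 0"
      using lim[OF cont bd(1)] by (simp add: LIMSEQ_const_iff)
    moreover have "integrable N f"
      by (rule N.integrable_const_bound[of _ 1]) (use bd in auto)
    ultimately have "AE t in N. f t = 0"
      using integral_nonneg_eq_0_iff_AE[of N f] bd by simp
    then show ?thesis
    proof (rule eventually_mono)
      fix t assume "f t = 0"
      then have "infdist t C = 0" by (auto simp: f_def min_def split: if_splits)
      then show "t \<in> C" using in_closed_iff_infdist_zero[OF clC neC] by simp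
    qed
  qed
  define p' where "p' = (\<lambda>t. if t \<in> C then p t else undefined)"
  have p' [measurable]: "p' \<in> borel_measurable borel"
    unfolding p'_def by (rule borel_measurable_extend_continuous[OF clC C(2)])
  define \<mu>' where "\<mu>' = distr N borel p'"
  show ?thesis
  proof (rule that[OF r])
    show prob': "prob_space \<mu>'" unfolding \<mu>'_def by (rule N.prob_space_distr) simp
    show sets': "sets \<mu>' = sets borel" by (simp add: \<mu>'_def)
    have "AE t in N. p' t \<in> K"
      using AE_N by (rule eventually_mono) (use C(3) in \<open>auto simp: p'_def\<close>)
    then have "AE u in \<mu>'. u \<in> K"
      unfolding \<mu>'_def by (subst AE_distr_iff) auto
    then show "measure \<mu>' K = 1"
      by (subst prob_space.prob_eq_1[OF prob']) (auto simp: sets')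
    fix h :: "'a \<Rightarrow> real" assume h: "continuous_on UNIV h"
    have [measurable]: "h \<in> borel_measurable borel"
      using h by (rule borel_measurable_continuous_onI)
    have hp: "continuous_on C (h \<circ> p)"
      by (intro continuous_on_compose C continuous_on_subset[OF h]) auto
    obtain B where B: "\<And>t. t \<in> C \<Longrightarrow> norm ((h \<circ> p) t) \<le> B"
      using compact_imp_bounded[OF compact_continuous_image[OF hp C(1)]] unfolding bounded_iff by auto
    have "0 \<le> B" using B neC norm_ge_zero order_trans by blast
    obtain H where H: "continuous_on UNIV H" "\<And>t. t \<in> C \<Longrightarrow> H t = (h \<circ> p) t" "\<And>t. norm (H t) \<le> B"
      using Tietze[OF hp _ \<open>0 \<le> B\<close> B, of UNIV] clC by auto
    have [measurable]: "H \<in> borel_measurable borel"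
      using H(1) by (rule borel_measurable_continuous_onI)
    have "integral\<^sup>L (\<nu> n) H = integral\<^sup>L (\<mu> n) h" for n
      unfolding \<nu>_def
      by (subst integral_distr)
        (use AE_K[of n] sC ps H(2) in \<open>auto elim!: eventually_mono intro!: integral_cong_AE\<close>)
    moreover have "integral\<^sup>L N H = integral\<^sup>L \<mu>' h"
    proof -
      have "AE t in N. H t = h (p' t)"
        using AE_N by (rule eventually_mono) (simp add: H(2) p'_def)
      then have "integral\<^sup>L N H = (\<integral>t. h (p' t) \<partial>N)"
        by (intro integral_cong_AE) auto
      then show ?thesis
        unfolding \<mu>'_def by (simp add: integral_distr)
    qed
    ultimately show "(\<lambda>n. integral\<^sup>L (\<mu> (r n)) h) \<longlonglongrightarrow> integral\<^sup>L \<mu>' h"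
      using lim[OF H(1,3)] by simp
  qed
qed

section \<open>Averaging a measure over a finite set of group elements\<close>

text \<open>
  The mean of the push-forwards of \<open>M\<close> under \<open>\<Phi> g\<close>, \<open>g \<in> S\<close>, written as the law of \<open>\<Phi> g x\<close> for
  independent \<open>g\<close>, uniform in \<open>S\<close>, and \<open>x\<close>, distributed by \<open>M\<close>.
\<close>
definition orbit_average :: "'g set \<Rightarrow> ('g \<Rightarrow> 'a \<Rightarrow> 'a) \<Rightarrow> 'a::topological_space measure \<Rightarrow> 'a measure" where
  "orbit_average S \<Phi> M = distr (uniform_count_measure S \<Otimes>\<^sub>M M) borel (\<lambda>(g, x). \<Phi> g x)"

context
  fixes S :: "'g set" and \<Phi> :: "'g \<Rightarrow> 'a \<Rightarrow> 'a::topological_space" and M :: "'a measure"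
  assumes S: "finite S" "S \<noteq> {}" and M: "prob_space M" "sets M = sets borel"
    and meas: "\<And>g. g \<in> S \<Longrightarrow> \<Phi> g \<in> borel_measurable borel"
begin

lemma measurable_orbit_map:
  "(\<lambda>(g, x). \<Phi> g x) \<in> borel_measurable (uniform_count_measure S \<Otimes>\<^sub>M M)"
proof -
  have "(\<lambda>(g, x). \<Phi> g x) \<in> borel_measurable (count_space S \<Otimes>\<^sub>M M)"
    by (rule measurable_pair_measure_countable1)
      (use S meas M(2) in \<open>auto simp: countable_finite cong: measurable_cong_sets\<close>)
  then show ?thesis
    by (simp cong: measurable_cong_sets sets_pair_measure_cong add: sets_uniform_count_measure_count_space)
qed

lemma prob_space_orbit_average: "prob_space (orbit_average S \<Phi> M)"
proof -
  interpret U: prob_space "uniform_count_measure S"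
    by (rule prob_space_uniform_count_measure[OF S])
  interpret M: prob_space M by (rule M)
  interpret P: pair_prob_space "uniform_count_measure S" M ..
  show ?thesis
    unfolding orbit_average_def by (rule P.prob_space_distr[OF measurable_orbit_map])
qed

lemma integral_orbit_average:
  fixes h :: "'a \<Rightarrow> real"
  assumes h: "h \<in> borel_measurable borel" "\<And>x. \<bar>h x\<bar> \<le> B"
  shows "integral\<^sup>L (orbit_average S \<Phi> M) h = (\<Sum>g\<in>S. \<integral>x. h (\<Phi> g x) \<partial>M) / real (card S)"
proof -
  interpret U: prob_space "uniform_count_measure S"
    by (rule prob_space_uniform_count_measure[OF S])
  interpret M: prob_space M by (rule M)
  interpret P: pair_prob_space "uniform_count_measure S" M ..
  let ?f = "\<lambda>(g, x). h (\<Phi> g x)"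
  have m: "?f \<in> borel_measurable (uniform_count_measure S \<Otimes>\<^sub>M M)"
    using measurable_compose[OF measurable_orbit_map h(1)] by (simp add: split_beta')
  have int: "integrable (uniform_count_measure S \<Otimes>\<^sub>M M) ?f"
    by (rule P.integrable_const_bound[of _ B]) (use m h(2) in auto)
  have "integral\<^sup>L (orbit_average S \<Phi> M) h = integral\<^sup>L (uniform_count_measure S \<Otimes>\<^sub>M M) ?f"
    unfolding orbit_average_def
    by (subst integral_distr[OF measurable_orbit_map h(1)]) (simp add: split_beta')
  also have "\<dots> = (\<integral>g. (\<integral>x. h (\<Phi> g x) \<partial>M) \<partial>uniform_count_measure S)"
    using P.integral_fst'[OF int] by simp
  also have "\<dots> = (\<Sum>g\<in>S. \<integral>x. h (\<Phi> g x) \<partial>M) / real (card S)"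
    by (rule integral_uniform_count_measure[OF S(1)])
  finally show ?thesis .
qed

lemma measure_orbit_average_eq_1:
  assumes K: "K \<in> sets borel" "measure M K = 1" and inv: "\<And>g u. g \<in> S \<Longrightarrow> u \<in> K \<Longrightarrow> \<Phi> g u \<in> K"
  shows "measure (orbit_average S \<Phi> M) K = 1"
proof -
  interpret M: prob_space M by (rule M)
  note [measurable_cong] = M(2)
  note [measurable] = K(1)
  have one: "(\<integral>x. indicator K (\<Phi> g x) \<partial>M) = (1 :: real)" if g: "g \<in> S" for g
  proof -
    note [measurable] = meas[OF g]
    have "(\<integral>x. indicator K (\<Phi> g x) \<partial>M) = (\<integral>x. (1::real) \<partial>M)"
      by (rule integral_cong_AE) (use M.AE_prob_1[OF K(2)] inv[OF g] in \<open>auto elim!: eventually_mono\<close>)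
    then show ?thesis by (simp add: M.prob_space)
  qed
  have "measure (orbit_average S \<Phi> M) K = (\<integral>x. indicator K x \<partial>orbit_average S \<Phi> M)"
    by (simp add: orbit_average_def)
  also have "\<dots> = (\<Sum>g\<in>S. \<integral>x. indicator K (\<Phi> g x) \<partial>M) / real (card S)"
    by (rule integral_orbit_average[where B = 1]) (auto simp: indicator_def)
  also have "\<dots> = 1"
    using one S by simp
  finally show ?thesis .
qed

end

lemma sets_orbit_average [simp]: "sets (orbit_average S \<Phi> M) = sets borel"
  by (simp add: orbit_average_def)

lemma abs_diff_sum_le_card_sym_diff:
  fixes a :: "'g \<Rightarrow> real"
  assumes "finite A" "finite B" "\<And>g. g \<in> sym_diff A B \<Longrightarrow> \<bar>a g\<bar> \<le> 1"
  shows "\<bar>sum a A - sum a B\<bar> \<le> real (card (sym_diff A B))"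
proof -
  have "sum a A = sum a (A \<inter> B) + sum a (A - B)" "sum a B = sum a (A \<inter> B) + sum a (B - A)"
    using assms(1,2) by (auto simp: sum.Int_Diff[of A _ B] sum.Int_Diff[of B _ A] Int_commute)
  then have "\<bar>sum a A - sum a B\<bar> \<le> \<bar>sum a (A - B)\<bar> + \<bar>sum a (B - A)\<bar>"
    by linarith
  also have "\<dots> \<le> (\<Sum>g\<in>A - B. \<bar>a g\<bar>) + (\<Sum>g\<in>B - A. \<bar>a g\<bar>)"
    by (intro add_mono sum_abs)
  also have "\<dots> = (\<Sum>g\<in>sym_diff A B. \<bar>a g\<bar>)"
    using assms(1,2) by (subst sum.union_disjoint) auto
  also have "\<dots> \<le> (\<Sum>g\<in>sym_diff A B. 1)"
    using assms(3) by (rule sum_mono)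
  finally show ?thesis by simp
qed

lemma invariant_measuresD:
  assumes "\<mu> \<in> invariant_measures G \<phi> K"
  shows "prob_space \<mu>" "sets \<mu> = sets borel" "measure \<mu> K = 1"
    "\<And>g. g \<in> carrier G \<Longrightarrow> distr \<mu> borel (\<phi> g) = \<mu>"
  using assms by (auto simp: invariant_measures_def borel_prob_measures_def)

lemma invariant_measuresI:
  assumes "prob_space \<mu>" "sets \<mu> = sets borel" "measure \<mu> K = 1"
    "\<And>g. g \<in> carrier G \<Longrightarrow> distr \<mu> borel (\<phi> g) = \<mu>"
  shows "\<mu> \<in> invariant_measures G \<phi> K"
  using assms by (auto simp: invariant_measures_def borel_prob_measures_def)

lemma (in group) sum_l_coset:
  assumes "g \<in> carrier G" "S \<subseteq> carrier G"
  shows "(\<Sum>k\<in>S. a (g \<otimes> k)) = (\<Sum>k\<in>g <# S. a k)"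
proof -
  have "g <# S = (\<lambda>k. g \<otimes> k) ` S"
    by (auto simp: l_coset_def)
  moreover have "inj_on (\<lambda>k. g \<otimes> k) S"
    using assms by (intro inj_onI) (auto simp: subset_iff)
  ultimately show ?thesis by (simp add: sum.reindex)
qed

lemma (in group) sum_r_coset:
  assumes "g \<in> carrier G" "S \<subseteq> carrier G"
  shows "(\<Sum>k\<in>S. a (k \<otimes> g)) = (\<Sum>k\<in>S #> g. a k)"
proof -
  have "S #> g = (\<lambda>k. k \<otimes> g) ` S"
    by (auto simp: r_coset_def)
  moreover have "inj_on (\<lambda>k. k \<otimes> g) S"
    using assms by (intro inj_onI) (auto simp: subset_iff)
  ultimately show ?thesis by (simp add: sum.reindex)
qed

text \<open>
  Applying \<open>\<Phi> g\<close> to the average over \<open>S\<close> gives the average over \<open>g <# S\<close>; the contributions of the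
  common part of the two index sets cancel. This is where the Folner condition enters.
\<close>
lemma (in group) orbit_average_asymptotically_invariant:
  fixes \<Phi> :: "'a \<Rightarrow> 'x::topological_space \<Rightarrow> 'x" and h :: "'x \<Rightarrow> real"
  assumes S: "finite S" "S \<noteq> {}" "S \<subseteq> carrier G" and g: "g \<in> carrier G"
    and M: "prob_space M" "sets M = sets borel"
    and cont: "\<And>k. k \<in> carrier G \<Longrightarrow> continuous_on UNIV (\<Phi> k)"
    and act: "\<And>k l z. k \<in> carrier G \<Longrightarrow> l \<in> carrier G \<Longrightarrow> \<Phi> (k \<otimes> l) z = \<Phi> k (\<Phi> l z)"
    and h: "continuous_on UNIV h" "\<And>z. 0 \<le> h z \<and> h z \<le> 1"
  shows "\<bar>(\<integral>z. h (\<Phi> g z) \<partial>orbit_average S \<Phi> M) - integral\<^sup>L (orbit_average S \<Phi> M) h\<bar>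
           \<le> real (card (sym_diff (g <# S) S)) / real (card S)"
proof -
  interpret M: prob_space M by (rule M)
  note [measurable_cong] = M(2)
  have meas: "\<Phi> k \<in> borel_measurable borel" if "k \<in> carrier G" for k
    using cont[OF that] by (rule borel_measurable_continuous_onI)
  have hm [measurable]: "h \<in> borel_measurable borel"
    using h(1) by (rule borel_measurable_continuous_onI)
  have habs: "\<bar>h z\<bar> \<le> 1" for z
    using h(2)[of z] by simp
  define a where "a k = (\<integral>z. h (\<Phi> k z) \<partial>M)" for k
  have a: "\<bar>a k\<bar> \<le> 1" if "k \<in> carrier G" for k
  proof -
    note [measurable] = meas[OF that]
    have int: "integrable M (\<lambda>z. h (\<Phi> k z))"
      by (rule M.integrable_const_bound[of _ 1]) (use habs in auto)
    have "a k \<le> (\<integral>z. 1 \<partial>M)"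
      unfolding a_def by (rule integral_mono[OF int]) (use h(2) in auto)
    moreover have "0 \<le> a k"
      unfolding a_def by (rule integral_nonneg_AE) (use h(2) in auto)
    ultimately show ?thesis by (simp add: M.prob_space)
  qed
  have hg: "(\<lambda>z. h (\<Phi> g z)) \<in> borel_measurable borel"
    using measurable_compose[OF meas[OF g] hm] .
  have measS: "\<And>k. k \<in> S \<Longrightarrow> \<Phi> k \<in> borel_measurable borel"
    using meas S(3) by auto
  have sub: "g <# S \<subseteq> carrier G"
    using g S(3) by (auto simp: l_coset_def)
  have "(\<integral>z. h (\<Phi> g z) \<partial>orbit_average S \<Phi> M) = (\<Sum>k\<in>S. \<integral>z. h (\<Phi> g (\<Phi> k z)) \<partial>M) / real (card S)"
    by (rule integral_orbit_average[OF S(1,2) M measS hg habs])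
  also have "(\<Sum>k\<in>S. \<integral>z. h (\<Phi> g (\<Phi> k z)) \<partial>M) = (\<Sum>k\<in>S. a (g \<otimes> k))"
    unfolding a_def using g S(3) by (intro sum.cong) (auto simp: act subset_iff)
  also have "\<dots> = (\<Sum>k\<in>g <# S. a k)"
    by (rule sum_l_coset[OF g S(3)])
  finally have 1: "(\<integral>z. h (\<Phi> g z) \<partial>orbit_average S \<Phi> M) = (\<Sum>k\<in>g <# S. a k) / real (card S)" .
  have 2: "integral\<^sup>L (orbit_average S \<Phi> M) h = (\<Sum>k\<in>S. a k) / real (card S)"
    unfolding a_def by (rule integral_orbit_average[OF S(1,2) M measS hm habs])
  have "\<bar>(\<Sum>k\<in>g <# S. a k) - (\<Sum>k\<in>S. a k)\<bar> \<le> real (card (sym_diff (g <# S) S))"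
    by (rule abs_diff_sum_le_card_sym_diff)
      (use S(1,3) sub a in \<open>auto simp: l_coset_def\<close>)
  then show ?thesis
    unfolding 1 2 by (simp add: diff_divide_distrib[symmetric] divide_right_mono)
qed

section \<open>Lifting invariant measures to extensions\<close>

text \<open>
  Invariant measures lift along factor maps of actions of amenable groups. A Borel section of \<open>\<pi>\<close>
  lifts \<open>\<mu>\<close> to a measure on \<open>K\<close> that need not be invariant. By equivariance its averages over the
  Folner sets still project to \<open>\<mu>\<close>, and so does every weak limit of them, which is invariant.
\<close>
proposition (in group) exists_invariant_lift:
  fixes \<Phi> :: "'a \<Rightarrow> 'x::metric_space \<Rightarrow> 'x" and \<phi> :: "'a \<Rightarrow> 'y::metric_space \<Rightarrow> 'y" and \<pi> :: "'x \<Rightarrow> 'y"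
  assumes F: "folner_sequence G F"
    and cont\<Phi>: "\<And>g. g \<in> carrier G \<Longrightarrow> continuous_on UNIV (\<Phi> g)"
    and act: "\<And>g h z. g \<in> carrier G \<Longrightarrow> h \<in> carrier G \<Longrightarrow> \<Phi> (g \<otimes> h) z = \<Phi> g (\<Phi> h z)"
    and cont\<phi>: "\<And>g. g \<in> carrier G \<Longrightarrow> continuous_on UNIV (\<phi> g)"
    and cont\<pi>: "continuous_on UNIV \<pi>"
    and equivariant: "\<And>g z. g \<in> carrier G \<Longrightarrow> \<pi> (\<Phi> g z) = \<phi> g (\<pi> z)"
    and K: "compact K" and inv: "\<And>g z. g \<in> carrier G \<Longrightarrow> z \<in> K \<Longrightarrow> \<Phi> g z \<in> K"
    and \<mu>: "\<mu> \<in> invariant_measures G \<phi> (\<pi> ` K)"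
  obtains \<kappa> where "\<kappa> \<in> invariant_measures G \<Phi> K" "distr \<kappa> borel \<pi> = \<mu>"
proof -
  note \<mu> = invariant_measuresD[OF \<mu>]
  interpret \<mu>: prob_space \<mu> by (rule \<mu>(1))
  note [measurable_cong] = \<mu>(2)
  have Fn: "F n \<subseteq> carrier G" "finite (F n)" "F n \<noteq> {}" for n
    using F by (auto simp: folner_sequence_def)
  have meas: "\<Phi> g \<in> borel_measurable borel" "\<phi> g \<in> borel_measurable borel" if "g \<in> carrier G" for g
    using cont\<Phi>[OF that] cont\<phi>[OF that] by (auto intro: borel_measurable_continuous_onI)
  have \<pi>m [measurable]: "\<pi> \<in> borel_measurable borel"
    using cont\<pi> by (rule borel_measurable_continuous_onI)
  have [measurable]: "K \<in> sets borel"
    using compact_imp_closed[OF K] by simp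
  obtain s where s [measurable]: "s \<in> borel_measurable borel"
    and sK: "\<And>u. u \<in> \<pi> ` K \<Longrightarrow> s u \<in> K" and \<pi>s: "\<And>u. u \<in> \<pi> ` K \<Longrightarrow> \<pi> (s u) = u"
    using borel_section_of_compact[OF K continuous_on_subset[OF cont\<pi>]] by blast
  have AE_\<mu>: "AE u in \<mu>. u \<in> \<pi> ` K"
    by (rule \<mu>.AE_prob_1[OF \<mu>(3)])
  define \<kappa>0 where "\<kappa>0 = distr \<mu> borel s"
  have \<kappa>0: "prob_space \<kappa>0" "sets \<kappa>0 = sets borel"
    unfolding \<kappa>0_def by (auto intro: \<mu>.prob_space_distr)
  have "AE z in \<kappa>0. z \<in> K"
    unfolding \<kappa>0_def by (subst AE_distr_iff) (use AE_\<mu> sK in \<open>auto elim!: eventually_mono\<close>)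
  then have \<kappa>0K: "measure \<kappa>0 K = 1"
    by (subst prob_space.prob_eq_1[OF \<kappa>0(1)]) (auto simp: \<kappa>0(2))
  have \<pi>\<kappa>0: "(\<integral>z. f (\<pi> z) \<partial>\<kappa>0) = integral\<^sup>L \<mu> f" if [measurable]: "f \<in> borel_measurable borel" for f :: "'y \<Rightarrow> real"
    unfolding \<kappa>0_def
    by (subst integral_distr)
      (use AE_\<mu> \<pi>s in \<open>auto elim!: eventually_mono intro!: integral_cong_AE\<close>)
  define M where "M n = orbit_average (F n) \<Phi> \<kappa>0" for n
  have measF: "\<And>g. g \<in> F n \<Longrightarrow> \<Phi> g \<in> borel_measurable borel" for n
    using meas(1) Fn(1) by blast
  have M: "prob_space (M n)" "sets (M n) = sets borel" "measure (M n) K = 1" for n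
  proof -
    show "prob_space (M n)"
      unfolding M_def by (rule prob_space_orbit_average[OF Fn(2,3) \<kappa>0 measF])
    show "measure (M n) K = 1"
      unfolding M_def by (rule measure_orbit_average_eq_1[OF Fn(2,3) \<kappa>0 measF _ \<kappa>0K])
        (use inv Fn(1) in \<open>auto simp: subset_iff\<close>)
  qed (simp add: M_def)
  obtain r \<kappa> where r: "strict_mono (r :: nat \<Rightarrow> nat)" and \<kappa>: "prob_space \<kappa>" "sets \<kappa> = sets borel" "measure \<kappa> K = 1"
    and lim: "\<And>h :: 'x \<Rightarrow> real. continuous_on UNIV h \<Longrightarrow> (\<lambda>n. integral\<^sup>L (M (r n)) h) \<longlonglongrightarrow> integral\<^sup>L \<kappa> h"
    by (rule compact_imp_weakly_convergent_subsequence[OF K M]) (rule that; simp)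
  interpret \<kappa>: prob_space \<kappa> by (rule \<kappa>(1))
  note [measurable_cong] = \<kappa>(2)
  have "distr \<kappa> borel (\<Phi> g) = \<kappa>" if g: "g \<in> carrier G" for g
  proof (rule borel_measure_eqI_continuous)
    note [measurable] = meas(1)[OF g]
    show "finite_measure (distr \<kappa> borel (\<Phi> g))"
      by (intro prob_space.finite_measure \<kappa>.prob_space_distr) simp
    show "finite_measure \<kappa>" by (rule \<kappa>.finite_measure_axioms)
    fix h :: "'x \<Rightarrow> real" assume h: "continuous_on UNIV h" "\<And>z. 0 \<le> h z \<and> h z \<le> 1"
    have [measurable]: "h \<in> borel_measurable borel"
      using h(1) by (rule borel_measurable_continuous_onI)
    have hg: "continuous_on UNIV (\<lambda>z. h (\<Phi> g z))"
      using continuous_on_compose2[OF h(1) cont\<Phi>[OF g]] by auto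
    let ?d = "\<lambda>n. (\<integral>z. h (\<Phi> g z) \<partial>M n) - integral\<^sup>L (M n) h"
    let ?\<delta> = "\<lambda>n. real (card (sym_diff (g <# F n) (F n))) / real (card (F n))"
    have "?\<delta> \<longlonglongrightarrow> 0"
      using F g by (auto simp: folner_sequence_def)
    then have "(\<lambda>n. ?\<delta> (r n)) \<longlonglongrightarrow> 0"
      using LIMSEQ_subseq_LIMSEQ[OF _ r] by (simp add: comp_def)
    moreover have "\<bar>?d n\<bar> \<le> ?\<delta> n" for n
      unfolding M_def by (rule orbit_average_asymptotically_invariant[OF Fn(2,3,1) g \<kappa>0 cont\<Phi> act h])
    ultimately have "(\<lambda>n. ?d (r n)) \<longlonglongrightarrow> 0"
      by (intro Lim_null_comparison[OF always_eventually, of "\<lambda>n. ?d (r n)" "\<lambda>n. ?\<delta> (r n)"]) simp_all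
    moreover have "(\<lambda>n. ?d (r n)) \<longlonglongrightarrow> (\<integral>z. h (\<Phi> g z) \<partial>\<kappa>) - integral\<^sup>L \<kappa> h"
      by (intro tendsto_diff lim hg h(1))
    ultimately have "(\<integral>z. h (\<Phi> g z) \<partial>\<kappa>) - integral\<^sup>L \<kappa> h = 0"
      using LIMSEQ_unique by blast
    then show "integral\<^sup>L (distr \<kappa> borel (\<Phi> g)) h = integral\<^sup>L \<kappa> h"
      by (simp add: integral_distr)
  qed (simp_all add: \<kappa>(2))
  then have "\<kappa> \<in> invariant_measures G \<Phi> K"
    by (intro invariant_measuresI \<kappa>)
  moreover have "distr \<kappa> borel \<pi> = \<mu>"
  proof (rule borel_measure_eqI_continuous)
    show "finite_measure (distr \<kappa> borel \<pi>)"
      by (intro prob_space.finite_measure \<kappa>.prob_space_distr) simp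
    show "finite_measure \<mu>" by (rule \<mu>.finite_measure_axioms)
    fix h :: "'y \<Rightarrow> real" assume h: "continuous_on UNIV h" "\<And>z. 0 \<le> h z \<and> h z \<le> 1"
    have hm [measurable]: "h \<in> borel_measurable borel"
      using h(1) by (rule borel_measurable_continuous_onI)
    have habs: "\<bar>h z\<bar> \<le> 1" for z
      using h(2)[of z] by simp
    have "(\<integral>z. h (\<pi> z) \<partial>M n) = integral\<^sup>L \<mu> h" for n
    proof -
      have each: "(\<integral>z. h (\<pi> (\<Phi> g z)) \<partial>\<kappa>0) = integral\<^sup>L \<mu> h" if "g \<in> F n" for g
      proof -
        have g: "g \<in> carrier G" using that Fn(1) by blast
        note [measurable] = meas(2)[OF g]
        have "(\<integral>z. h (\<pi> (\<Phi> g z)) \<partial>\<kappa>0) = (\<integral>z. h (\<phi> g (\<pi> z)) \<partial>\<kappa>0)"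
          by (simp add: equivariant[OF g])
        also have "\<dots> = (\<integral>u. h (\<phi> g u) \<partial>\<mu>)"
          by (rule \<pi>\<kappa>0) simp
        also have "\<dots> = integral\<^sup>L (distr \<mu> borel (\<phi> g)) h"
          by (simp add: integral_distr)
        finally show ?thesis by (simp add: \<mu>(4)[OF g])
      qed
      have "(\<integral>z. h (\<pi> z) \<partial>M n) = (\<Sum>g\<in>F n. \<integral>z. h (\<pi> (\<Phi> g z)) \<partial>\<kappa>0) / real (card (F n))"
        unfolding M_def
        by (rule integral_orbit_average[OF Fn(2,3) \<kappa>0 measF, where B = 1]) (use habs in auto)
      then show ?thesis using each Fn(2,3) by simp
    qed
    moreover have "(\<lambda>n. \<integral>z. h (\<pi> z) \<partial>M (r n)) \<longlonglongrightarrow> (\<integral>z. h (\<pi> z) \<partial>\<kappa>)"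
      using continuous_on_compose2[OF h(1) cont\<pi>] by (intro lim) auto
    ultimately show "integral\<^sup>L (distr \<kappa> borel \<pi>) h = integral\<^sup>L \<mu> h"
      by (simp add: integral_distr LIMSEQ_const_iff)
  qed (simp_all add: \<mu>(2))
  ultimately show ?thesis using that by blast
qed

section \<open>The Weyl pseudometric bounds the transport cost of a joining\<close>
lemma weyl_dist_commute: "weyl_dist G F \<phi> x y = weyl_dist G F \<phi> y x"
  by (simp add: weyl_dist_def dist_commute)

text \<open>
  By invariance the integral of the distance does not change if the distance is replaced by its
  average over \<open>F n\<close>. At a point \<open>(\<phi> g x, \<phi> g y)\<close> of the orbit that average is a sum over
  \<open>F n #> g\<close>, so it is bounded by the \<open>n\<close>-th term in the definition of the Weyl pseudometric. The bound
  does not depend on \<open>g\<close> and passes to the closure of the orbit, which carries \<open>\<kappa>\<close>.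
\<close>
proposition (in group) integral_dist_le_weyl_dist:
  fixes \<phi> :: "'a \<Rightarrow> 'x::metric_space \<Rightarrow> 'x"
  assumes F: "folner_sequence G F"
    and cont: "\<And>g. g \<in> carrier G \<Longrightarrow> continuous_on UNIV (\<phi> g)"
    and act: "\<And>g h z. g \<in> carrier G \<Longrightarrow> h \<in> carrier G \<Longrightarrow> \<phi> (g \<otimes> h) z = \<phi> g (\<phi> h z)"
    and bounded: "\<And>u v :: 'x. dist u v \<le> B"
    and \<kappa>: "\<kappa> \<in> invariant_measures G (\<lambda>g. map_prod (\<phi> g) (\<phi> g)) (closure {(\<phi> g x, \<phi> g y) |g. g \<in> carrier G})"
  shows "ereal (\<integral>z. dist (fst z) (snd z) \<partial>\<kappa>) \<le> weyl_dist G F \<phi> x y"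
proof -
  let ?D = "{(\<phi> g x, \<phi> g y) |g. g \<in> carrier G}"
  note \<kappa> = invariant_measuresD[OF \<kappa>]
  interpret \<kappa>: prob_space \<kappa> by (rule \<kappa>(1))
  note [measurable_cong] = \<kappa>(2)
  let ?\<rho> = "\<lambda>z :: 'x \<times> 'x. dist (fst z) (snd z)"
  let ?I = "integral\<^sup>L \<kappa> ?\<rho>"
  have \<rho>_m [measurable]: "?\<rho> \<in> borel_measurable borel"
    by (intro borel_measurable_continuous_onI continuous_intros)
  have cont_f: "continuous_on UNIV (\<lambda>z :: 'x \<times> 'x. dist (\<phi> f (fst z)) (\<phi> f (snd z)))" if "f \<in> carrier G" for f
    by (intro continuous_on_dist continuous_on_compose2[OF cont[OF that]] continuous_intros) auto
  have meas_f: "(\<lambda>z :: 'x \<times> 'x. dist (\<phi> f (fst z)) (\<phi> f (snd z))) \<in> borel_measurable borel" if "f \<in> carrier G" for f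
    using cont_f[OF that] by (rule borel_measurable_continuous_onI)
  have int_f: "integrable \<kappa> (\<lambda>z. dist (\<phi> f (fst z)) (\<phi> f (snd z)))" if "f \<in> carrier G" for f
    by (rule \<kappa>.integrable_const_bound[of _ B]) (use meas_f[OF that] bounded in auto)
  have shift: "(\<integral>z. dist (\<phi> f (fst z)) (\<phi> f (snd z)) \<partial>\<kappa>) = ?I" if f: "f \<in> carrier G" for f
  proof -
    have [measurable]: "map_prod (\<phi> f) (\<phi> f) \<in> borel_measurable borel"
      unfolding map_prod_def split_beta
      by (intro borel_measurable_continuous_onI continuous_on_Pair continuous_on_compose2[OF cont[OF f]] continuous_intros) auto
    have "integral\<^sup>L (distr \<kappa> borel (map_prod (\<phi> f) (\<phi> f))) ?\<rho> = (\<integral>z. dist (\<phi> f (fst z)) (\<phi> f (snd z)) \<partial>\<kappa>)"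
      by (subst integral_distr) simp_all
    then show ?thesis by (simp add: \<kappa>(4)[OF f])
  qed
  have "ereal ?I \<le> ereal (1 / real (card (F n))) *
       (SUP g\<in>carrier G. ereal (\<Sum>f\<in>F n #> g. dist (\<phi> f x) (\<phi> f y)))" (is "_ \<le> _ * ?S") for n
  proof -
    have Fn: "F n \<subseteq> carrier G" "finite (F n)" "F n \<noteq> {}"
      using F by (auto simp: folner_sequence_def)
    let ?s = "\<lambda>z. \<Sum>f\<in>F n. dist (\<phi> f (fst z)) (\<phi> f (snd z))"
    have cont_s: "continuous_on UNIV ?s"
      using Fn(1) by (intro continuous_on_sum cont_f) auto
    have "closed {z. ereal (?s z) \<le> ?S}"
      by (intro closed_Collect_le continuous_on_ereal cont_s continuous_on_const)
    moreover have "?D \<subseteq> {z. ereal (?s z) \<le> ?S}"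
    proof clarsimp
      fix g assume g: "g \<in> carrier G"
      have "(\<Sum>f\<in>F n. dist (\<phi> f (\<phi> g x)) (\<phi> f (\<phi> g y))) = (\<Sum>f\<in>F n. dist (\<phi> (f \<otimes> g) x) (\<phi> (f \<otimes> g) y))"
        using Fn(1) g by (intro sum.cong) (auto simp: act subset_iff)
      also have "\<dots> = (\<Sum>f\<in>F n #> g. dist (\<phi> f x) (\<phi> f y))"
        by (rule sum_r_coset[OF g Fn(1)])
      finally show "ereal (\<Sum>f\<in>F n. dist (\<phi> f (\<phi> g x)) (\<phi> f (\<phi> g y))) \<le> ?S"
        using g by (auto intro: SUP_upper)
    qed
    ultimately have le: "ereal (?s z) \<le> ?S" if "z \<in> closure ?D" for z
      using closure_minimal that by blast
    have AE: "AE z in \<kappa>. ereal (?s z) \<le> ?S"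
      using \<kappa>.AE_prob_1[OF \<kappa>(3)] by (rule eventually_mono) (rule le)
    have int_s: "integrable \<kappa> ?s"
      using Fn(1) by (intro Bochner_Integration.integrable_sum int_f) auto
    have "integral\<^sup>L \<kappa> ?s = (\<Sum>f\<in>F n. ?I)"
      using Fn(1) int_f shift by (subst Bochner_Integration.integral_sum) (auto simp: subset_iff)
    then have eq: "integral\<^sup>L \<kappa> ?s = real (card (F n)) * ?I"
      by simp
    have "ereal (integral\<^sup>L \<kappa> ?s) \<le> ?S"
    proof (cases ?S)
      case (real c)
      then have "AE z in \<kappa>. ?s z \<le> c" using AE by simp
      then have "integral\<^sup>L \<kappa> ?s \<le> (\<integral>z. c \<partial>\<kappa>)"
        by (intro integral_mono_AE int_s) auto
      then show ?thesis by (simp add: real \<kappa>.prob_space)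
    next
      case MInf
      then have "AE z in \<kappa>. False" using AE by simp
      then show ?thesis by simp
    qed simp
    then have "ereal (1 / real (card (F n))) * ereal (integral\<^sup>L \<kappa> ?s) \<le> ereal (1 / real (card (F n))) * ?S"
      by (intro ereal_mult_left_mono) auto
    then show ?thesis
      using Fn(2,3) by (simp add: eq)
  qed
  then show ?thesis
    unfolding weyl_dist_def by (intro le_Limsup always_eventually allI) auto
qed

text \<open>
  If \<open>snd z \<in> B\<close> then either \<open>fst z\<close> lies in the \<open>\<eta>\<close>-neighbourhood of \<open>B\<close> or the two coordinates are
  at least \<open>\<eta>\<close> apart, and by Markov's inequality the latter has probability at most $\eta^2 / \eta$.
\<close>
lemma prokhorov_dist_le_of_coupling:
  fixes \<kappa> :: "('x::metric_space \<times> 'x) measure"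
  assumes \<kappa>: "prob_space \<kappa>" "sets \<kappa> = sets borel" and \<eta>: "0 < \<eta>"
    and int: "integrable \<kappa> (\<lambda>z. dist (fst z) (snd z))" and le: "(\<integral>z. dist (fst z) (snd z) \<partial>\<kappa>) \<le> \<eta>\<^sup>2"
  shows "prokhorov_dist (distr \<kappa> borel snd) (distr \<kappa> borel fst) \<le> \<eta>"
proof -
  interpret \<kappa>: prob_space \<kappa> by (rule \<kappa>(1))
  note [measurable_cong] = \<kappa>(2)
  have sp: "space \<kappa> = UNIV"
    using sets_eq_imp_space_eq[OF \<kappa>(2)] by simp
  have [measurable]: "(fst :: 'x \<times> 'x \<Rightarrow> 'x) \<in> borel_measurable borel" "(snd :: 'x \<times> 'x \<Rightarrow> 'x) \<in> borel_measurable borel"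
    by (auto intro!: borel_measurable_continuous_onI continuous_intros)
  have \<rho>_m [measurable]: "(\<lambda>z :: 'x \<times> 'x. dist (fst z) (snd z)) \<in> borel_measurable borel"
    by (intro borel_measurable_continuous_onI continuous_intros)
  have far: "measure \<kappa> {z \<in> space \<kappa>. \<eta> \<le> dist (fst z) (snd z)} \<le> \<eta>"
  proof -
    have "measure \<kappa> {z \<in> space \<kappa>. \<eta> \<le> dist (fst z) (snd z)} \<le> (\<integral>z. dist (fst z) (snd z) \<partial>\<kappa>) / \<eta>"
      by (rule integral_Markov_inequality_measure[OF int, of "{}"]) (use \<eta> in auto)
    also have "\<dots> \<le> \<eta>\<^sup>2 / \<eta>"
      using le \<eta> by (intro divide_right_mono) auto
    finally show ?thesis using \<eta> by (simp add: power2_eq_square)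
  qed
  have "measure (distr \<kappa> borel snd) B \<le> measure (distr \<kappa> borel fst) (eps_nbhd UNIV dist B \<eta>) + \<eta>"
    if [measurable]: "B \<in> sets borel" for B
  proof -
    have "eps_nbhd UNIV dist B \<eta> = (\<Union>x\<in>B. ball x \<eta>)"
      by (auto simp: eps_nbhd_def)
    moreover have "open (\<Union>x\<in>B. ball x \<eta>)"
      by (intro open_UN ballI open_ball)
    ultimately have nb: "eps_nbhd UNIV dist B \<eta> \<in> sets borel"
      by simp
    have "measure (distr \<kappa> borel snd) B = measure \<kappa> (snd -` B \<inter> space \<kappa>)"
      by (rule measure_distr) simp_all
    also have "\<dots> \<le> measure \<kappa> ((fst -` eps_nbhd UNIV dist B \<eta> \<inter> space \<kappa>) \<union> {z \<in> space \<kappa>. \<eta> \<le> dist (fst z) (snd z)})"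
    proof (rule \<kappa>.finite_measure_mono)
      show "snd -` B \<inter> space \<kappa> \<subseteq> (fst -` eps_nbhd UNIV dist B \<eta> \<inter> space \<kappa>) \<union> {z \<in> space \<kappa>. \<eta> \<le> dist (fst z) (snd z)}"
        by (auto simp: eps_nbhd_def dist_commute not_le)
    qed (use nb in measurable)
    also have "\<dots> \<le> measure \<kappa> (fst -` eps_nbhd UNIV dist B \<eta> \<inter> space \<kappa>) + measure \<kappa> {z \<in> space \<kappa>. \<eta> \<le> dist (fst z) (snd z)}"
      by (rule measure_Un_le) (use nb in measurable)
    also have "measure \<kappa> (fst -` eps_nbhd UNIV dist B \<eta> \<inter> space \<kappa>) = measure (distr \<kappa> borel fst) (eps_nbhd UNIV dist B \<eta>)"
      by (rule measure_distr[symmetric]) (use nb in simp_all)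
    finally show ?thesis using far by simp
  qed
  then show ?thesis
    unfolding prokhorov_dist_def using \<eta> by (intro cInf_lower bdd_belowI[of _ 0]) auto
qed

section \<open>Invariant measures on orbit closures\<close>

text \<open>
  The first projection maps the orbit closure \<open>K\<close> of \<open>(x, y)\<close> onto the orbit closure of \<open>x\<close>: the image
  is compact, hence closed, and contains the orbit. So \<open>\<mu>\<close> lifts to an invariant measure on \<open>K\<close>, and
  the second marginal of the lift is the measure \<open>\<nu>\<close> that is sought.
\<close>
proposition (in group) invariant_measure_near:
  fixes \<phi> :: "'a \<Rightarrow> 'x::metric_space \<Rightarrow> 'x"
  assumes F: "folner_sequence G F"
    and cont: "\<And>g. g \<in> carrier G \<Longrightarrow> continuous_on UNIV (\<phi> g)"
    and act: "\<And>g h z. g \<in> carrier G \<Longrightarrow> h \<in> carrier G \<Longrightarrow> \<phi> (g \<otimes> h) z = \<phi> g (\<phi> h z)"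
    and X: "compact (UNIV :: 'x set)"
    and \<eta>: "0 < \<eta>" and close: "weyl_dist G F \<phi> x y < ereal (\<eta>\<^sup>2)"
    and \<mu>: "\<mu> \<in> invariant_measures G \<phi> (closure (orbit G \<phi> x))"
  obtains \<nu> where "\<nu> \<in> invariant_measures G \<phi> (closure (orbit G \<phi> y))" "prokhorov_dist \<nu> \<mu> \<le> \<eta>"
proof -
  define D where "D = {(\<phi> g x, \<phi> g y) |g. g \<in> carrier G}"
  define \<Phi> where "\<Phi> = (\<lambda>g. map_prod (\<phi> g) (\<phi> g))"
  define K where "K = closure D"
  have cont\<Phi>: "continuous_on UNIV (\<Phi> g)" if g: "g \<in> carrier G" for g
    unfolding \<Phi>_def map_prod_def split_beta
    by (intro continuous_on_Pair continuous_on_compose2[OF cont[OF g]] continuous_intros) auto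
  have act\<Phi>: "\<Phi> (g \<otimes> h) z = \<Phi> g (\<Phi> h z)" if "g \<in> carrier G" "h \<in> carrier G" for g h z
    using act[OF that] by (simp add: \<Phi>_def map_prod_def split_beta)
  have "compact (UNIV :: ('x \<times> 'x) set)"
    using compact_Times[OF X X] by simp
  then have compK: "compact K"
    using compact_Int_closed[of UNIV K] by (simp add: K_def)
  have invK: "\<Phi> g z \<in> K" if g: "g \<in> carrier G" and z: "z \<in> K" for g z
  proof -
    have "\<Phi> g ` D \<subseteq> D"
    proof clarsimp
      fix a b assume "(a, b) \<in> D"
      then obtain h where h: "h \<in> carrier G" "a = \<phi> h x" "b = \<phi> h y" by (auto simp: D_def)
      then have "\<Phi> g (a, b) = (\<phi> (g \<otimes> h) x, \<phi> (g \<otimes> h) y)"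
        using act[OF g h(1)] by (simp add: \<Phi>_def)
      then show "\<Phi> g (a, b) \<in> D"
        using g h(1) by (auto simp: D_def)
    qed
    then have "\<Phi> g ` closure D \<subseteq> closure D"
      by (intro image_closure_subset continuous_on_subset[OF cont\<Phi>[OF g]])
        (use closure_subset in \<open>auto\<close>)
    then show ?thesis using z by (auto simp: K_def)
  qed
  have fstK: "fst ` K = closure (orbit G \<phi> x)"
  proof (rule antisym)
    have "fst ` D \<subseteq> closure (orbit G \<phi> x)"
      using closure_subset by (fastforce simp: D_def orbit_def)
    then show "fst ` K \<subseteq> closure (orbit G \<phi> x)"
      unfolding K_def by (intro image_closure_subset) (auto intro: continuous_intros)
    have "closed (fst ` K)"
      by (intro compact_imp_closed compact_continuous_image compK continuous_intros)
    moreover have "orbit G \<phi> x \<subseteq> fst ` K"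
    proof
      fix u assume "u \<in> orbit G \<phi> x"
      then obtain g where "g \<in> carrier G" "u = \<phi> g x" by (auto simp: orbit_def)
      then have "(u, \<phi> g y) \<in> D"
        by (auto simp: D_def)
      then have "(u, \<phi> g y) \<in> K"
        unfolding K_def by (rule subsetD[OF closure_subset])
      then show "u \<in> fst ` K" by force
    qed
    ultimately show "closure (orbit G \<phi> x) \<subseteq> fst ` K"
      by (rule closure_minimal[rotated])
  qed
  have sndK: "snd z \<in> closure (orbit G \<phi> y)" if "z \<in> K" for z
  proof -
    have "snd ` D \<subseteq> closure (orbit G \<phi> y)"
      using closure_subset by (fastforce simp: D_def orbit_def)
    then have "snd ` K \<subseteq> closure (orbit G \<phi> y)"
      unfolding K_def by (intro image_closure_subset) (auto intro: continuous_intros)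
    then show ?thesis using that by auto
  qed
  have \<mu>K: "\<mu> \<in> invariant_measures G \<phi> (fst ` K)"
    using \<mu> by (simp add: fstK)
  obtain \<kappa> where \<kappa>: "\<kappa> \<in> invariant_measures G \<Phi> K" and \<kappa>\<mu>: "distr \<kappa> borel fst = \<mu>"
    by (rule exists_invariant_lift[OF F cont\<Phi> act\<Phi> cont _ _ compK invK \<mu>K])
      (auto intro: continuous_intros simp: \<Phi>_def)
  note \<kappa>' = invariant_measuresD[OF \<kappa>]
  interpret \<kappa>: prob_space \<kappa> by (rule \<kappa>'(1))
  note [measurable_cong] = \<kappa>'(2)
  obtain B where B: "\<And>u v :: 'x. dist u v \<le> B"
    using compact_imp_bounded[OF X] by (auto simp: bounded_two_points)
  have snd_m [measurable]: "(snd :: 'x \<times> 'x \<Rightarrow> 'x) \<in> borel_measurable borel"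
    by (auto intro!: borel_measurable_continuous_onI continuous_intros)
  have \<rho>_m: "(\<lambda>z :: 'x \<times> 'x. dist (fst z) (snd z)) \<in> borel_measurable borel"
    by (intro borel_measurable_continuous_onI continuous_intros)
  have int: "integrable \<kappa> (\<lambda>z. dist (fst z) (snd z))"
    by (rule \<kappa>.integrable_const_bound[of _ B]) (use \<rho>_m B in auto)
  have "ereal (\<integral>z. dist (fst z) (snd z) \<partial>\<kappa>) \<le> weyl_dist G F \<phi> x y"
    using integral_dist_le_weyl_dist[OF F cont act B \<kappa>[unfolded \<Phi>_def K_def D_def]] .
  also note close
  finally have "(\<integral>z. dist (fst z) (snd z) \<partial>\<kappa>) \<le> \<eta>\<^sup>2"
    by simp
  then have "prokhorov_dist (distr \<kappa> borel snd) \<mu> \<le> \<eta>"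
    using prokhorov_dist_le_of_coupling[OF \<kappa>'(1,2) \<eta> int] \<kappa>\<mu> by simp
  moreover have "distr \<kappa> borel snd \<in> invariant_measures G \<phi> (closure (orbit G \<phi> y))"
  proof (rule invariant_measuresI)
    show prob: "prob_space (distr \<kappa> borel snd)"
      by (rule \<kappa>.prob_space_distr) simp
    have "AE u in distr \<kappa> borel snd. u \<in> closure (orbit G \<phi> y)"
      by (subst AE_distr_iff) (use \<kappa>.AE_prob_1[OF \<kappa>'(3)] sndK in \<open>auto elim!: eventually_mono\<close>)
    then show "measure (distr \<kappa> borel snd) (closure (orbit G \<phi> y)) = 1"
      by (subst prob_space.prob_eq_1[OF prob]) auto
    fix g assume g: "g \<in> carrier G"
    have [measurable]: "\<phi> g \<in> borel_measurable borel" "\<Phi> g \<in> borel_measurable borel"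
      using cont[OF g] cont\<Phi>[OF g] by (auto intro: borel_measurable_continuous_onI)
    have "distr (distr \<kappa> borel snd) borel (\<phi> g) = distr \<kappa> borel (\<phi> g \<circ> snd)"
      by (rule distr_distr) simp_all
    also have "\<phi> g \<circ> snd = snd \<circ> \<Phi> g"
      by (auto simp: \<Phi>_def)
    also have "distr \<kappa> borel (snd \<circ> \<Phi> g) = distr (distr \<kappa> borel (\<Phi> g)) borel snd"
      by (rule distr_distr[symmetric]) simp_all
    finally show "distr (distr \<kappa> borel snd) borel (\<phi> g) = distr \<kappa> borel snd"
      by (simp add: \<kappa>'(4)[OF g])
  qed simp
  ultimately show ?thesis using that by blast
qed

lemma hausdorff_dist_le:
  assumes "0 < \<epsilon>" "A \<subseteq> eps_nbhd S d B \<epsilon>" "B \<subseteq> eps_nbhd S d A \<epsilon>"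
  shows "hausdorff_dist S d A B \<le> ereal \<epsilon>"
  unfolding hausdorff_dist_def using assms by (intro max.boundedI Inf_lower) auto

theorem corollary23:
  fixes G :: "('g, 'b) monoid_scheme"
    and \<phi> :: "'g \<Rightarrow> 'x::metric_space \<Rightarrow> 'x"
    and F :: "nat \<Rightarrow> 'g set"
  assumes "group G" and "countable (carrier G)" and "amenable G"
    and "compact (UNIV :: 'x set)" and "diameter (UNIV :: 'x set) \<le> 1"
    and "group_action G UNIV \<phi>"
    and "continuous_map (prod_topology (discrete_topology (carrier G)) euclidean) euclidean
           (\<lambda>(g, x). \<phi> g x)"
    and "folner_sequence G F"
  shows "\<forall>\<epsilon>>0. \<exists>\<delta>>0. \<forall>x y. weyl_dist G F \<phi> x y < ereal \<delta> \<longrightarrow>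
           hausdorff_dist borel_prob_measures prokhorov_dist
             (invariant_measures G \<phi> (closure (orbit G \<phi> x)))
             (invariant_measures G \<phi> (closure (orbit G \<phi> y))) < ereal \<epsilon>"
proof (intro allI impI)
  interpret group G by fact
  interpret group_action G UNIV \<phi> by fact
  have cont: "continuous_on UNIV (\<phi> g)" if g: "g \<in> carrier G" for g
  proof -
    have "continuous_map euclidean (prod_topology (discrete_topology (carrier G)) euclidean) (\<lambda>x. (g, x))"
      using g by (simp add: continuous_map_pairedI)
    from continuous_map_compose[OF this assms(7)] show ?thesis
      by (simp add: comp_def)
  qed
  have act: "\<phi> (g \<otimes>\<^bsub>G\<^esub> h) z = \<phi> g (\<phi> h z)" if "g \<in> carrier G" "h \<in> carrier G" for g h z
    using composition_rule[of z g h] that by simp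
  \<comment> \<open>Neighbourhoods and the final estimate are strict while the coupling bound is not, whence
    the choice of \<open>\<epsilon> / 3 < \<epsilon> / 2 < \<epsilon>\<close>.\<close>
  fix \<epsilon> :: real assume \<epsilon>: "0 < \<epsilon>"
  have near: "invariant_measures G \<phi> (closure (orbit G \<phi> x))
      \<subseteq> eps_nbhd borel_prob_measures prokhorov_dist (invariant_measures G \<phi> (closure (orbit G \<phi> y))) (\<epsilon> / 2)"
    if close: "weyl_dist G F \<phi> x y < ereal ((\<epsilon> / 3)\<^sup>2)" for x y
  proof
    fix \<mu> assume \<mu>: "\<mu> \<in> invariant_measures G \<phi> (closure (orbit G \<phi> x))"
    obtain \<nu> where \<nu>: "\<nu> \<in> invariant_measures G \<phi> (closure (orbit G \<phi> y))" "prokhorov_dist \<nu> \<mu> \<le> \<epsilon> / 3"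
      using invariant_measure_near[OF assms(8) cont act assms(4) _ close \<mu>] \<epsilon> by auto
    have "prokhorov_dist \<nu> \<mu> < \<epsilon> / 2"
      using \<nu>(2) \<epsilon> by simp
    moreover have "\<mu> \<in> borel_prob_measures"
      using \<mu> by (simp add: invariant_measures_def)
    ultimately show "\<mu> \<in> eps_nbhd borel_prob_measures prokhorov_dist (invariant_measures G \<phi> (closure (orbit G \<phi> y))) (\<epsilon> / 2)"
      using \<nu>(1) by (auto simp: eps_nbhd_def)
  qed
  have "hausdorff_dist borel_prob_measures prokhorov_dist
             (invariant_measures G \<phi> (closure (orbit G \<phi> x)))
             (invariant_measures G \<phi> (closure (orbit G \<phi> y))) < ereal \<epsilon>"
    if close: "weyl_dist G F \<phi> x y < ereal ((\<epsilon> / 3)\<^sup>2)" for x y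
  proof -
    have "weyl_dist G F \<phi> y x < ereal ((\<epsilon> / 3)\<^sup>2)"
      using close by (simp add: weyl_dist_commute)
    then have "hausdorff_dist borel_prob_measures prokhorov_dist
             (invariant_measures G \<phi> (closure (orbit G \<phi> x)))
             (invariant_measures G \<phi> (closure (orbit G \<phi> y))) \<le> ereal (\<epsilon> / 2)"
      using near close \<epsilon> by (intro hausdorff_dist_le) auto
    also have "\<dots> < ereal \<epsilon>" using \<epsilon> by simp
    finally show ?thesis .
  qed
  then show "\<exists>\<delta>>0. \<forall>x y. weyl_dist G F \<phi> x y < ereal \<delta> \<longrightarrow>
           hausdorff_dist borel_prob_measures prokhorov_dist
             (invariant_measures G \<phi> (closure (orbit G \<phi> x)))
             (invariant_measures G \<phi> (closure (orbit G \<phi> y))) < ereal \<epsilon>"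
    using \<epsilon> by (intro exI[of _ "(\<epsilon> / 3)\<^sup>2"]) auto
qed

end
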